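(* Let $T$ be a tree on $n\ge 2$ vertices with maximum degree $\Delta$. Then 1. $S(T)=\frac{4(n-2)}{n}+\frac{2(n-2)}{n}\sum_{i=3}^{\Delta}N_i(i-2)$; 2. $\mathrm{Var}(T)=\frac{2(n-2)}{n^2}+\frac1n\sum_{i=3}^{\Delta}N_i(i-1)(i-2)$; 3. $IRR(T)=\frac n2(\Delta-1)$; 4. $IRD(T)\le \dfrac{4N_\Delta(\Delta-1)+2N_\Delta\sum_{i=3}^{\Delta}(i-2)N_i(\Delta-1)}{2+(\Delta-1)N_\Delta}$, with equality if and only if the set of vertex degrees of $T$ is contained in $\{1,2,\Delta\}$.
   Context: $N_i$ denotes the number of vertices of degree $i$ (sums over $i$ from $3$ to $\Delta$ are empty if $\Delta<3$). For a graph with $n$ vertices, $m$ edges, degrees $d_1,\dots,d_n$, maximum degree $\Delta$, minimum degree $\delta$: $S(G)=\sum_i|d_i-\frac{2m}{n}|$, $\mathrm{Var}(G)=\frac1n\sum_i(d_i-\frac{2m}{n})^2$, $IRR(G)=\frac n2(\Delta-\delta)$, $IRD(G)=\frac{2N_\Delta N_\delta}{N_\delta+N_\Delta}(\Delta-\delta)$ (for a tree, $\delta=1$). *)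

theory Defs
  imports Complex_Main "Graph_Theory.Digraph_Component"
begin

text \<open>
  Finite simple graphs are the symmetric, loop-free digraphs without parallel arcs of the locale
  \<^locale>\<open>graph\<close>: every undirected edge is represented by its two opposite arcs. Hence
  \<open>connected\<close> is the library's notion, the degree of a vertex is its number of outgoing
  arcs, and an edge is the set of the two ends of an arc.

  The library predicate \<open>tree\<close> is not usable for such graphs: traversing an edge back and
  forth is a directed cycle of length 2, so it would admit no graph with an edge. The cycles of
  the undirected graph are exactly the directed cycles of length at least 3.
\<close>

definition undirected_tree :: "('a, 'b) pre_digraph \<Rightarrow> bool" where
  "undirected_tree G \<longleftrightarrow>
     graph G \<and> connected G \<and> \<not> (\<exists>p. pre_digraph.cycle G p \<and> 3 \<le> length p)"

definition edges :: "('a, 'b) pre_digraph \<Rightarrow> 'a set set" where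
  "edges G = (\<lambda>a. {tail G a, head G a}) ` arcs G"

abbreviation degree :: "('a, 'b) pre_digraph \<Rightarrow> 'a \<Rightarrow> nat" where
  "degree G v \<equiv> out_degree G v"

definition max_degree :: "('a, 'b) pre_digraph \<Rightarrow> nat" where
  "max_degree G = Max (degree G ` verts G)"

definition min_degree :: "('a, 'b) pre_digraph \<Rightarrow> nat" where
  "min_degree G = Min (degree G ` verts G)"

definition num_deg :: "('a, 'b) pre_digraph \<Rightarrow> nat \<Rightarrow> nat" where
  "num_deg G i = card {v \<in> verts G. degree G v = i}"

definition mean_degree :: "('a, 'b) pre_digraph \<Rightarrow> real" where
  "mean_degree G = 2 * real (card (edges G)) / real (card (verts G))"

definition S_index :: "('a, 'b) pre_digraph \<Rightarrow> real" where
  "S_index G = (\<Sum>v\<in>verts G. \<bar>real (degree G v) - mean_degree G\<bar>)"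

definition Var_index :: "('a, 'b) pre_digraph \<Rightarrow> real" where
  "Var_index G =
     1 / real (card (verts G)) * (\<Sum>v\<in>verts G. (real (degree G v) - mean_degree G)\<^sup>2)"

definition IRR :: "('a, 'b) pre_digraph \<Rightarrow> real" where
  "IRR G = real (card (verts G)) / 2 * (real (max_degree G) - real (min_degree G))"

definition IRD :: "('a, 'b) pre_digraph \<Rightarrow> real" where
  "IRD G =
     2 * real (num_deg G (max_degree G)) * real (num_deg G (min_degree G))
       / (real (num_deg G (min_degree G)) + real (num_deg G (max_degree G)))
       * (real (max_degree G) - real (min_degree G))"

end

theory Submission
  imports Defs
begin

text \<open>
  The start of a longest path in a graph without cycles of length at least 3 is a leaf, so
  deleting leaves one at a time gives the edge count \<open>n - 1\<close>. Hence the degrees sum to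
  \<open>2 * (n - 1)\<close>, which gives \<open>N\<^sub>1 = 2 + (\<Sum>i\<ge>3. (i - 2) * N\<^sub>i)\<close>. The
  mean degree lies between 1 and 2, so only leaves lie below it and the sum of absolute deviations
  is twice their total deficit. For the bound on \<open>IRD\<close>, the \<open>i = \<Delta>\<close> term of
  this sum yields \<open>N\<^sub>1 + N\<^sub>\<Delta> \<ge> 2 + (\<Delta> - 1) * N\<^sub>\<Delta>\<close>,
  and the gap is made up of the degrees strictly between 2 and \<open>\<Delta>\<close>.
\<close>

subsection \<open>Leaves\<close>

lemma (in graph) ex_reverse_arc:
  assumes "e \<in> arcs G"
  obtains e' where "e' \<in> arcs G" "tail G e' = head G e" "head G e' = tail G e"
  using sym_arcs assms unfolding symmetric_conv by metis

text \<open>Let \<open>e\<close> be the first arc of a longest path. An arc \<open>f\<close> into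
  the start comes from a vertex of the path and closes the segment up to it to a cycle, so that
  segment has at most one arc. The leaf is \<open>tail G e\<close>, with degree 1 stated as
  uniqueness of the arc leaving it.\<close>

lemma (in graph) no_long_cycle_ex_leaf:
  assumes acyc: "\<not> (\<exists>p. cycle p \<and> 3 \<le> length p)" and "arcs G \<noteq> {}"
  obtains e where "e \<in> arcs G" "\<And>f. \<lbrakk>f \<in> arcs G; tail G f = tail G e\<rbrakk> \<Longrightarrow> f = e"
proof -
  define P where "P = (\<lambda>p. \<exists>u v. apath u p v)"
  from \<open>arcs G \<noteq> {}\<close> obtain a where "a \<in> arcs G" by blast
  then have "apath (tail G a) [a] (head G a)"
    using no_loops[of a] by (simp add: apath_simps)
  then have "P [a]"
    unfolding P_def by blast
  moreover have "\<forall>p. P p \<longrightarrow> length p \<le> card (verts G)"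
    unfolding P_def using length_apath by blast
  ultimately obtain p where p: "P p" and longest: "\<And>q. P q \<Longrightarrow> length q \<le> length p"
    using ex_has_greatest_nat[of P "[a]" length "Suc (card (verts G))"] by (auto simp: less_Suc_eq_le)
  from longest[OF \<open>P [a]\<close>] obtain e p' where p': "p = e # p'"
    by (cases p) auto
  from p obtain v where path: "apath (tail G e) p v"
    unfolding P_def p' by (auto simp: apath_simps)
  then have e: "e \<in> arcs G"
    unfolding p' by (auto simp: apath_simps)
  have pred: "tail G f = head G e" if f: "f \<in> arcs G" "head G f = tail G e" for f
  proof -
    have "tail G f \<in> set (awalk_verts (tail G e) p)"
    proof (rule ccontr)
      \<comment> \<open>Otherwise \<open>f\<close> prolongs the path at its start, against
        maximality.\<close>
      assume "\<not> ?thesis"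
      with f path have "apath (tail G f) (f # p) v"
        by (auto simp: apath_simps)
      with longest[of "f # p"] show False
        unfolding P_def by auto
    qed
    then obtain q r where p_eq: "p = q @ r" and q: "awalk (tail G e) q (tail G f)"
      using awalk_decomp[OF awalkI_apath[OF path]] by blast
    have "distinct (awalk_verts (tail G e) q)"
      using path q unfolding p_eq apath_append_iff by (auto simp: apath_def)
    then have "cycle (f # q)"
      unfolding cycle_def using f q by (auto simp: awalk_Cons_iff intro!: exI[of _ "tail G f"])
    with acyc have "length q \<le> 1"
      by (metis One_nat_def Suc_le_mono length_Cons not_less_eq_eq numeral_3_eq_3)
    \<comment> \<open>For \<open>q = []\<close> the arc \<open>f\<close> would be a loop; for
      \<open>q = [e]\<close> it is the reverse of \<open>e\<close>.\<close>
    then consider "q = []" | "q = [e]"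
      using p_eq p' by (cases q) auto
    then show ?thesis
      using q f no_loops[of f] by cases (auto simp: awalk_simps)
  qed
  have "f = e" if "f \<in> arcs G" "tail G f = tail G e" for f
  proof -
    obtain f' where "f' \<in> arcs G" "tail G f' = head G f" "head G f' = tail G f"
      using ex_reverse_arc \<open>f \<in> arcs G\<close> .
    with pred[of f'] that have "head G f = head G e" by simp
    with that e show ?thesis
      by (intro no_multi_arcs) (auto simp: arc_to_ends_def)
  qed
  with e show thesis by (rule that)
qed

lemma (in graph) graph_del_vert: "graph (del_vert u)"
proof -
  interpret H: wf_digraph "del_vert u" by (rule wf_digraph_del_vert)
  have "symmetric (del_vert u)"
    using sym_arcs unfolding symmetric_conv by (fastforce simp: del_vert_simps)
  then show ?thesis
    by unfold_locales
      (auto simp: del_vert_simps arc_to_ends_def dest: no_loops intro: no_multi_arcs)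
qed

text \<open>A walk through the leaf comes from its only neighbour \<open>head G e\<close> and
  returns there, so the detour can be cut out.\<close>

lemma (in graph) strongly_connected_del_leaf:
  assumes conn: "strongly_connected G" and e: "e \<in> arcs G"
    and only_e: "\<And>f. \<lbrakk>f \<in> arcs G; tail G f = tail G e\<rbrakk> \<Longrightarrow> f = e"
  shows "strongly_connected (del_vert (tail G e))"
proof -
  let ?H = "del_vert (tail G e)"
  interpret H: graph ?H by (rule graph_del_vert)
  have [simp]: "head G e \<noteq> tail G e"
    using no_loops e by metis
  \<comment> \<open>The induction may pass through the leaf; there the claim moves the end of the
    walk to the neighbour.\<close>
  have walk: "x \<rightarrow>\<^sup>*\<^bsub>?H\<^esub> (if y = tail G e then head G e else y)"
    if "x \<rightarrow>\<^sup>* y" "x \<noteq> tail G e" for x y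
    using that
  proof (induction rule: reachable_induct)
    case base
    then show ?case by (simp add: del_vert_simps)
  next
    case (step y z)
    from \<open>y \<rightarrow>\<^bsub>G\<^esub> z\<close> obtain f where f: "f \<in> arcs G" "tail G f = y" "head G f = z" by blast
    obtain f' where f': "f' \<in> arcs G" "tail G f' = z" "head G f' = y"
      using ex_reverse_arc[OF f(1), unfolded f(2,3)] .
    note IH = step.IH[OF step.prems]
    consider "z = tail G e" | "y = tail G e" "z \<noteq> tail G e" | "y \<noteq> tail G e" "z \<noteq> tail G e"
      by blast
    then show ?case
    proof cases
      case 1
      with only_e[of f'] f' have "y = head G e" by simp
      with 1 IH show ?thesis by simp
    next
      case 2
      with only_e[of f] f have "z = head G e" by simp
      with 2 IH show ?thesis by simp
    next
      case 3
      with f have "y \<rightarrow>\<^bsub>?H\<^esub> z"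
        by (intro H.dominatesI[of f]) (simp_all add: del_vert_simps arc_to_ends_def)
      with 3 IH show ?thesis by (simp add: H.reachable_adj_trans)
    qed
  qed
  have "x \<rightarrow>\<^sup>*\<^bsub>?H\<^esub> y" if "x \<in> verts ?H" "y \<in> verts ?H" for x y
  proof -
    from that have "x \<rightarrow>\<^sup>* y" "x \<noteq> tail G e" "y \<noteq> tail G e"
      using conn by (simp_all add: del_vert_simps strongly_connected_def)
    with walk[of x y] show ?thesis by simp
  qed
  moreover have "head G e \<in> verts ?H"
    using e by (simp add: del_vert_simps)
  ultimately show ?thesis by (intro strongly_connectedI) auto
qed

subsection \<open>Edge count\<close>

text \<open>Each edge is two arcs, so this is twice \<open>m = n - 1\<close>, written without
  subtraction on \<open>nat\<close>. Deleting a leaf removes one vertex and two arcs.\<close>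

lemma card_arcs_tree:
  assumes "graph G" "strongly_connected G" "\<not> (\<exists>p. pre_digraph.cycle G p \<and> 3 \<le> length p)"
  shows "card (arcs G) + 2 = 2 * card (verts G)"
  using assms
proof (induction "card (verts G)" arbitrary: G rule: less_induct)
  case less
  then interpret graph G by simp
  show ?case
  proof (cases "arcs G = {}")
    case True
    have "u = v" if "u \<in> verts G" "v \<in> verts G" for u v
    proof -
      have "u \<rightarrow>\<^sup>*\<^bsub>G\<^esub> v"
        using less.prems(2) that by (simp add: strongly_connected_def)
      with True show ?thesis
        by (auto simp: arcs_ends_def elim: converse_reachable_cases)
    qed
    moreover obtain u where "u \<in> verts G"
      using less.prems(2) by (auto simp: strongly_connected_def)
    ultimately have "verts G = {u}" by blast
    then have "card (verts G) = 1" by simp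
    with True show ?thesis by simp
  next
    case False
    with less.prems(3) obtain e
      where e: "e \<in> arcs G" and only_e: "\<And>f. \<lbrakk>f \<in> arcs G; tail G f = tail G e\<rbrakk> \<Longrightarrow> f = e"
      using no_long_cycle_ex_leaf by blast
    obtain e' where e': "e' \<in> arcs G" "tail G e' = head G e" "head G e' = tail G e"
      using ex_reverse_arc e .
    let ?H = "del_vert (tail G e)"
    have card_verts: "card (verts G) = Suc (card (verts ?H))"
      using card.remove[OF finite_verts, of "tail G e"] e by (simp add: del_vert_simps)
    \<comment> \<open>An arc into the leaf reverses to the only arc out of it, so exactly
      \<open>e\<close> and \<open>e'\<close> disappear.\<close>
    have only_e': "f = e'" if f: "f \<in> arcs G" "head G f = tail G e" for f
    proof -
      obtain f' where f': "f' \<in> arcs G" "tail G f' = head G f" "head G f' = tail G f"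
        using ex_reverse_arc f(1) .
      with only_e[of f'] f have "f' = e" by simp
      with f f' e' show ?thesis
        by (intro no_multi_arcs) (auto simp: arc_to_ends_def)
    qed
    have "arcs G = insert e (insert e' (arcs ?H))"
      unfolding del_vert_simps using only_e only_e' e e'(1) by blast
    moreover have "e \<noteq> e'" "e \<notin> arcs ?H" "e' \<notin> arcs ?H" "finite (arcs ?H)"
      using no_loops[OF e] e' by (auto simp: del_vert_simps)
    ultimately have card_arcs: "card (arcs G) = card (arcs ?H) + 2"
      by simp
    have "card (arcs ?H) + 2 = 2 * card (verts ?H)"
    proof (rule less.hyps)
      show "card (verts ?H) < card (verts G)" using card_verts by simp
      show "graph ?H" by (rule graph_del_vert)
      show "strongly_connected ?H"
        using less.prems(2) e only_e by (rule strongly_connected_del_leaf)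
      show "\<not> (\<exists>p. pre_digraph.cycle ?H p \<and> 3 \<le> length p)"
        using less.prems(3) subgraph_cycle[OF subgraph_del_vert] by blast
    qed
    with card_verts card_arcs show ?thesis by simp
  qed
qed

lemma (in fin_digraph) sum_out_degree: "(\<Sum>v\<in>verts G. out_degree G v) = card (arcs G)"
  using sum.group[of "arcs G" "verts G" "tail G" "\<lambda>_. 1::nat"]
  by (simp add: out_degree_def out_arcs_def image_subset_iff)

text \<open>The fibre of an edge consists of an arc and its reverse: there are no parallel arcs to
  add a third, and no loops to make the two coincide.\<close>

lemma (in graph) card_arcs_eq_twice_edges: "card (arcs G) = 2 * card (edges G)"
proof -
  have "card {a \<in> arcs G. {tail G a, head G a} = x} = 2" if "x \<in> edges G" for x
  proof -
    from that obtain e where e: "e \<in> arcs G" "x = {tail G e, head G e}"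
      by (auto simp: edges_def)
    obtain e' where e': "e' \<in> arcs G" "tail G e' = head G e" "head G e' = tail G e"
      using ex_reverse_arc e(1) .
    have "f = e \<or> f = e'" if "f \<in> arcs G" "{tail G f, head G f} = x" for f
      using no_multi_arcs[OF that(1) e(1)] no_multi_arcs[OF that(1) e'(1)] that e e'
      by (auto simp: arc_to_ends_def doubleton_eq_iff)
    then have "{a \<in> arcs G. {tail G a, head G a} = x} = {e, e'}"
      using e e' by auto
    moreover have "e \<noteq> e'"
      using no_loops[OF e(1)] e' by auto
    ultimately show ?thesis by simp
  qed
  then show ?thesis
    using sum.group[of "arcs G" "edges G" "\<lambda>a. {tail G a, head G a}" "\<lambda>_. 1::nat"]
    by (simp add: edges_def)
qed

subsection \<open>Degrees of a tree\<close>

text \<open>By symmetry, connectedness gives strong connectedness, so the arc count applies; it is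
  then read once through edges and once through degrees.\<close>

lemma undirected_tree_card_edges:
  assumes "undirected_tree G"
  shows "Suc (card (edges G)) = card (verts G)"
    and "(\<Sum>v\<in>verts G. degree G v) + 2 = 2 * card (verts G)"
proof -
  interpret graph G using assms by (simp add: undirected_tree_def)
  have "card (arcs G) + 2 = 2 * card (verts G)"
    using assms by (intro card_arcs_tree symmetric_connected_imp_strongly_connected)
      (auto simp: undirected_tree_def)
  then show "Suc (card (edges G)) = card (verts G)"
    and "(\<Sum>v\<in>verts G. degree G v) + 2 = 2 * card (verts G)"
    by (simp_all add: card_arcs_eq_twice_edges sum_out_degree)
qed

text \<open>A walk from \<open>v\<close> to a second vertex starts with an arc leaving
  \<open>v\<close>.\<close>

lemma undirected_tree_degree_pos:
  assumes "undirected_tree G" "2 \<le> card (verts G)" "v \<in> verts G"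
  shows "1 \<le> degree G v"
proof -
  interpret graph G using assms by (simp add: undirected_tree_def)
  have "strongly_connected G"
    using assms by (intro symmetric_connected_imp_strongly_connected) (auto simp: undirected_tree_def)
  moreover have "verts G \<noteq> {v}"
    using assms(2) by auto
  then obtain w where "w \<in> verts G" "w \<noteq> v"
    using assms(3) by blast
  ultimately have "v \<rightarrow>\<^sup>*\<^bsub>G\<^esub> w" using assms(3) by (auto simp: strongly_connected_def)
  then obtain x where "v \<rightarrow>\<^bsub>G\<^esub> x"
    using \<open>w \<noteq> v\<close> by (auto elim: converse_reachable_cases)
  then obtain e where "e \<in> arcs G" "tail G e = v" by blast
  then have "out_arcs G v \<noteq> {}" by auto
  then show ?thesis
    using finite_out_arcs by (simp add: out_degree_def Suc_le_eq card_gt_0_iff)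
qed

text \<open>Sums over degree values become sums over vertices, so that identities can be checked at
  each vertex separately.\<close>

lemma sum_num_deg:
  fixes f :: "nat \<Rightarrow> real"
  assumes "finite (verts G)"
  shows "(\<Sum>i=a..max_degree G. real (num_deg G i) * f i)
    = (\<Sum>v\<in>verts G. if a \<le> degree G v then f (degree G v) else 0)"
proof -
  let ?V = "{v \<in> verts G. a \<le> degree G v}"
  have "degree G ` ?V \<subseteq> {a..max_degree G}"
    using assms by (auto simp: max_degree_def)
  then have "(\<Sum>v\<in>?V. f (degree G v))
      = (\<Sum>i=a..max_degree G. \<Sum>v\<in>{v \<in> ?V. degree G v = i}. f (degree G v))"
    using assms by (intro sum.group[symmetric]) auto
  also have "\<dots> = (\<Sum>i=a..max_degree G. real (num_deg G i) * f i)"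
  proof (intro sum.cong refl)
    fix i assume "i \<in> {a..max_degree G}"
    then have "{v \<in> ?V. degree G v = i} = {v \<in> verts G. degree G v = i}" by auto
    then show "(\<Sum>v\<in>{v \<in> ?V. degree G v = i}. f (degree G v)) = real (num_deg G i) * f i"
      by (simp add: num_deg_def)
  qed
  finally show ?thesis
    using assms by (simp add: sum.inter_filter)
qed

lemma num_deg_eq_sum:
  assumes "finite (verts G)"
  shows "real (num_deg G i) = (\<Sum>v\<in>verts G. if degree G v = i then 1 else 0)"
  using assms by (simp add: num_deg_def flip: sum.inter_filter)

text \<open>The numbers \<open>degree G v - 2\<close> sum to -2. A leaf contributes -1, a vertex of
  degree 2 nothing, and the others form the sum on the right.\<close>

lemma undirected_tree_leaves:
  assumes "undirected_tree G" "2 \<le> card (verts G)"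
  shows "real (num_deg G 1) = 2 + (\<Sum>i=3..max_degree G. real (num_deg G i) * (real i - 2))"
proof -
  interpret graph G using assms by (simp add: undirected_tree_def)
  note pos = undirected_tree_degree_pos[OF assms]
  let ?d = "\<lambda>v. real (degree G v)"
  have "(\<Sum>v\<in>verts G. ?d v) + 2 = 2 * real (card (verts G))"
    using undirected_tree_card_edges(2)[OF assms(1)]
    by (metis of_nat_add of_nat_mult of_nat_numeral of_nat_sum)
  then have "(\<Sum>v\<in>verts G. ?d v - 2) = -2"
    by (simp add: sum_subtractf)
  moreover have "(\<Sum>v\<in>verts G. ?d v - 2)
      = (\<Sum>v\<in>verts G. (if 3 \<le> degree G v then ?d v - 2 else 0) - (if degree G v = 1 then 1 else 0))"
  proof (intro sum.cong refl)
    fix v assume "v \<in> verts G"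
    with pos[of v] consider "degree G v = 1" | "degree G v = 2" | "3 \<le> degree G v" by linarith
    then show "?d v - 2
        = (if 3 \<le> degree G v then ?d v - 2 else 0) - (if degree G v = 1 then 1 else 0)"
      by cases auto
  qed
  ultimately show ?thesis
    using sum_num_deg[OF finite_verts, where a = 3 and f = "\<lambda>i. real i - 2"]
      num_deg_eq_sum[OF finite_verts, of 1]
    by (simp add: sum_subtractf)
qed

text \<open>The leaf formula has only nonnegative summands besides the 2, so a leaf exists.\<close>

lemma undirected_tree_min_degree:
  assumes "undirected_tree G" "2 \<le> card (verts G)"
  shows "min_degree G = 1"
proof -
  interpret graph G using assms by (simp add: undirected_tree_def)
  have "0 \<le> (\<Sum>i=3..max_degree G. real (num_deg G i) * (real i - 2))"
    by (intro sum_nonneg) auto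
  with undirected_tree_leaves[OF assms] have "num_deg G 1 \<noteq> 0" by linarith
  then have "{v \<in> verts G. degree G v = 1} \<noteq> {}"
    unfolding num_deg_def by (metis card.empty)
  then show ?thesis
    unfolding min_degree_def using undirected_tree_degree_pos[OF assms]
    by (intro Min_eqI) force+
qed

section \<open>Irregularity indices of a tree\<close>

theorem theorem22:
  fixes T :: "('a, 'b) pre_digraph" and n \<Delta> :: nat and N :: "nat \<Rightarrow> nat"
  assumes "undirected_tree T"
    and "n = card (verts T)" and "n \<ge> 2"
    and "\<Delta> = max_degree T"
    and "N = num_deg T"
  shows "S_index T = 4 * (real n - 2) / real n
           + 2 * (real n - 2) / real n * (\<Sum>i=3..\<Delta>. real (N i) * (real i - 2))
    \<and> Var_index T = 2 * (real n - 2) / (real n)\<^sup>2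
           + 1 / real n * (\<Sum>i=3..\<Delta>. real (N i) * (real i - 1) * (real i - 2))
    \<and> IRR T = real n / 2 * (real \<Delta> - 1)
    \<and> (let B = (4 * real (N \<Delta>) * (real \<Delta> - 1)
               + 2 * real (N \<Delta>) * (\<Sum>i=3..\<Delta>. (real i - 2) * real (N i) * (real \<Delta> - 1)))
             / (2 + (real \<Delta> - 1) * real (N \<Delta>))
       in IRD T \<le> B \<and> (IRD T = B \<longleftrightarrow> degree T ` verts T \<subseteq> {1, 2, \<Delta>}))"
proof -
  note tree = \<open>undirected_tree T\<close>
  interpret graph T using tree by (simp add: undirected_tree_def)
  let ?d = "\<lambda>v. real (degree T v)"
  have card: "2 \<le> card (verts T)" "real n > 0" and n: "real n \<ge> 2" using assms by auto
  note pos = undirected_tree_degree_pos[OF tree card(1)]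
  note leaves = undirected_tree_leaves[OF tree card(1), folded assms(4,5)]
  note min_deg = undirected_tree_min_degree[OF tree card(1)]
  have sum_d: "(\<Sum>v\<in>verts T. ?d v) = 2 * (real n - 1)"
  proof -
    have "(\<Sum>v\<in>verts T. ?d v) + 2 = 2 * real n"
      using undirected_tree_card_edges(2)[OF tree] \<open>n = card (verts T)\<close>
      by (metis of_nat_add of_nat_mult of_nat_numeral of_nat_sum)
    then show ?thesis by simp
  qed
  define \<mu> where "\<mu> = mean_degree T"
  have mean: "\<mu> = 2 * (real n - 1) / real n"
    using undirected_tree_card_edges(1)[OF tree] \<open>n = card (verts T)\<close>
    unfolding \<mu>_def mean_degree_def by (metis add_diff_cancel_left' of_nat_Suc)
  \<comment> \<open>The mean \<open>2 - 2 / n\<close> separates the leaves from all other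
    vertices.\<close>
  have mean_bounds: "1 \<le> \<mu>" "\<mu> < 2"
    using n by (auto simp: mean field_simps)

  \<comment> \<open>Only at a leaf is the deviation, \<open>1 - \<mu>\<close>, not positive; adding
    \<open>2 * (\<mu> - 1)\<close> flips its sign. The signed deviations sum to 0, so just the
    corrections at the \<open>N 1\<close> leaves remain.\<close>
  have "S_index T = (\<Sum>v\<in>verts T. (?d v - \<mu>) + 2 * (\<mu> - 1) * (if degree T v = 1 then 1 else 0))"
    unfolding S_index_def \<mu>_def[symmetric]
  proof (intro sum.cong refl)
    fix v assume "v \<in> verts T"
    with pos[of v] consider "degree T v = 1" | "2 \<le> ?d v" "degree T v \<noteq> 1" by fastforce
    then show "\<bar>?d v - \<mu>\<bar> = (?d v - \<mu>) + 2 * (\<mu> - 1) * (if degree T v = 1 then 1 else 0)"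
      using mean_bounds by cases auto
  qed
  also have "\<dots> = (2 * (real n - 1) - real n * \<mu>) + 2 * (\<mu> - 1) * real (N 1)"
    using assms(2,5) sum_d by (simp add: sum.distrib sum_subtractf num_deg_eq_sum flip: sum_distrib_left)
  also have "\<dots> = 2 * (real n - 2) / real n * real (N 1)"
    using n by (simp add: mean field_simps)
  also have "\<dots> = 4 * (real n - 2) / real n
      + 2 * (real n - 2) / real n * (\<Sum>i=3..\<Delta>. real (N i) * (real i - 2))"
    unfolding leaves by (simp add: distrib_left)
  finally have S: "S_index T = \<dots>" .

  \<comment> \<open>Subtracting \<open>(x - 1) * (x - 2)\<close> from \<open>(x - \<mu>)^2\<close>
    leaves \<open>(3 - 2 * \<mu>) * x + (\<mu>^2 - 2)\<close>. The product vanishes at 1 and 2, so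
    it may be restricted to degrees from 3 on.\<close>
  have "(\<Sum>v\<in>verts T. (?d v - \<mu>)\<^sup>2)
      = (\<Sum>v\<in>verts T. (if 3 \<le> degree T v then (?d v - 1) * (?d v - 2) else 0)
          + (3 - 2 * \<mu>) * ?d v + (\<mu>\<^sup>2 - 2))"
  proof (intro sum.cong refl)
    fix v assume "v \<in> verts T"
    with pos[of v] consider "degree T v = 1" | "degree T v = 2" | "3 \<le> degree T v" by linarith
    then show "(?d v - \<mu>)\<^sup>2
        = (if 3 \<le> degree T v then (?d v - 1) * (?d v - 2) else 0) + (3 - 2 * \<mu>) * ?d v + (\<mu>\<^sup>2 - 2)"
      by cases (auto simp: power2_eq_square algebra_simps)
  qed
  also have "\<dots> = (\<Sum>i=3..\<Delta>. real (N i) * ((real i - 1) * (real i - 2)))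
      + (3 - 2 * \<mu>) * (2 * (real n - 1)) + real n * (\<mu>\<^sup>2 - 2)"
    using assms(2,4,5) sum_d by (simp add: sum.distrib sum_num_deg flip: sum_distrib_left)
  finally have "Var_index T = 1 / real n * ((\<Sum>i=3..\<Delta>. real (N i) * ((real i - 1) * (real i - 2)))
      + (3 - 2 * \<mu>) * (2 * (real n - 1)) + real n * (\<mu>\<^sup>2 - 2))"
    using assms(2) by (simp add: Var_index_def \<mu>_def)
  \<comment> \<open>As \<open>2 * (n - 1) = n * \<mu>\<close>, the last two terms add up to
    \<open>n * (\<mu> - 1) * (2 - \<mu>)\<close>, which is \<open>2 * (n - 2) / n\<close>.\<close>
  also have "\<dots> = 2 * (real n - 2) / (real n)\<^sup>2
      + 1 / real n * (\<Sum>i=3..\<Delta>. real (N i) * ((real i - 1) * (real i - 2)))"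
    using n by (simp add: mean power2_eq_square field_simps)
  finally have Var: "Var_index T = 2 * (real n - 2) / (real n)\<^sup>2
      + 1 / real n * (\<Sum>i=3..\<Delta>. real (N i) * (real i - 1) * (real i - 2))"
    by (simp add: mult.assoc)

  have IRR: "IRR T = real n / 2 * (real \<Delta> - 1)"
    using assms(2,4) min_deg by (simp add: IRR_def)

  define B where "B = (4 * real (N \<Delta>) * (real \<Delta> - 1)
      + 2 * real (N \<Delta>) * (\<Sum>i=3..\<Delta>. (real i - 2) * real (N i) * (real \<Delta> - 1)))
      / (2 + (real \<Delta> - 1) * real (N \<Delta>))"
  \<comment> \<open>The leaf formula turns the numerator of \<open>B\<close> into that of
    \<open>IRD T\<close>, so only the denominators differ.\<close>
  have B: "B = 2 * real (N \<Delta>) * real (N 1) * (real \<Delta> - 1) / (2 + (real \<Delta> - 1) * real (N \<Delta>))"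
  proof -
    have "(\<Sum>i=3..\<Delta>. (real i - 2) * real (N i) * (real \<Delta> - 1)) = (real (N 1) - 2) * (real \<Delta> - 1)"
      unfolding leaves by (simp add: sum_distrib_left mult_ac)
    then show ?thesis
      unfolding B_def by (simp only:) (simp add: algebra_simps)
  qed
  have IRD: "IRD T = 2 * real (N \<Delta>) * real (N 1) * (real \<Delta> - 1) / (real (N 1) + real (N \<Delta>))"
    using assms(4,5) min_deg by (simp add: IRD_def)
  have "verts T \<noteq> {}" using card by auto
  then have \<Delta>_in: "\<Delta> \<in> degree T ` verts T" and \<Delta>_max: "\<And>v. v \<in> verts T \<Longrightarrow> degree T v \<le> \<Delta>"
    unfolding assms(4) max_degree_def by (auto intro!: Max_in)
  have N_eq_0: "N i = 0 \<longleftrightarrow> i \<notin> degree T ` verts T" for i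
    unfolding assms(5) num_deg_def by auto
  have "\<Delta> \<ge> 1" using \<Delta>_in pos by auto
  then consider "\<Delta> = 1" | "\<Delta> \<ge> 2" by linarith
  then have "IRD T \<le> B \<and> (IRD T = B \<longleftrightarrow> degree T ` verts T \<subseteq> {1, 2, \<Delta>})"
  proof cases
    \<comment> \<open>Here \<open>N 1\<close> and \<open>N \<Delta>\<close> coincide and the
      splitting of \<open>N 1\<close> used in the other case fails, but the factor
      \<open>\<Delta> - 1\<close> makes both sides 0.\<close>
    case 1
    then have "degree T v = 1" if "v \<in> verts T" for v
      using pos \<Delta>_max that by (simp add: antisym)
    then show ?thesis using 1 by (auto simp: IRD B)
  next
    case 2
    \<comment> \<open>The share of the degrees strictly between 2 and \<open>\<Delta>\<close> in the
      leaf formula; it is the difference of the two denominators.\<close>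
    define R where "R = (\<Sum>i=3..<\<Delta>. real (N i) * (real i - 2))"
    have "real (N 1) = 2 + (real \<Delta> - 2) * real (N \<Delta>) + R"
    \<comment> \<open>For \<open>\<Delta> = 2\<close> the sum has no term at
      \<open>\<Delta>\<close>, which agrees with the coefficient \<open>\<Delta> - 2\<close> being
      0.\<close>
    proof (cases "\<Delta> = 2")
      case True
      then show ?thesis using leaves by (simp add: R_def)
    next
      case False
      with 2 have "{3..\<Delta>} = insert \<Delta> {3..<\<Delta>}" by auto
      then show ?thesis using leaves by (simp add: R_def)
    qed
    then have denom: "real (N 1) + real (N \<Delta>) = 2 + (real \<Delta> - 1) * real (N \<Delta>) + R"
      by (simp add: algebra_simps)
    have "R \<ge> 0"
      unfolding R_def by (intro sum_nonneg) auto
    have "R = 0 \<longleftrightarrow> (\<forall>i\<in>{3..<\<Delta>}. N i = 0)"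
      unfolding R_def by (subst sum_nonneg_eq_0_iff) auto
    also have "\<dots> \<longleftrightarrow> degree T ` verts T \<subseteq> {1, 2, \<Delta>}"
    proof -
      have "d \<in> {3..<\<Delta>} \<longleftrightarrow> d \<notin> {1, 2, \<Delta>}" if "d \<in> degree T ` verts T" for d
      proof -
        have "1 \<le> d" "d \<le> \<Delta>" using that pos \<Delta>_max by auto
        then show ?thesis by auto
      qed
      then show ?thesis unfolding N_eq_0 by blast
    qed
    finally have R_eq_0: "R = 0 \<longleftrightarrow> degree T ` verts T \<subseteq> {1, 2, \<Delta>}" .
    define A where "A = 2 * real (N \<Delta>) * real (N 1) * (real \<Delta> - 1)"
    define D where "D = 2 + (real \<Delta> - 1) * real (N \<Delta>)"
    have "N \<Delta> > 0"
      using N_eq_0[of \<Delta>] \<Delta>_in by simp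
    moreover have "real (N 1) > 0"
      using leaves sum_nonneg[of "{3..\<Delta>}" "\<lambda>i. real (N i) * (real i - 2)"] by simp
    ultimately have "A > 0" and "D > 0"
      using 2 by (auto simp: A_def D_def intro!: mult_pos_pos add_pos_nonneg)
    have IRD': "IRD T = A / (D + R)" and B': "B = A / D"
      unfolding IRD B A_def D_def denom by (simp_all add: add.assoc)
    have "IRD T \<le> B"
      unfolding IRD' B' using \<open>A > 0\<close> \<open>D > 0\<close> \<open>R \<ge> 0\<close> by (intro frac_le) auto
    \<comment> \<open>The common numerator is strictly positive, so equal quotients force equal
      denominators.\<close>
    moreover have "IRD T = B \<longleftrightarrow> R = 0"
      unfolding IRD' B' using \<open>A > 0\<close> \<open>D > 0\<close> \<open>R \<ge> 0\<close> by (simp add: frac_eq_eq)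
    ultimately show ?thesis using R_eq_0 by simp
  qed
  with S Var IRR show ?thesis
    unfolding B_def by (simp add: Let_def)
qed

end
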